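(* For any $n\ge 4$ and $i\in\{1,\dots,n-2\}$, the semiring $\mathcal{E}_{\lozenge_n}(a_i)$ is a union of the three subsemirings $\mathcal{E}^{[0,i]}_{\lozenge_n}$, $\mathcal{E}^{[i,1]}_{\lozenge_n}$ and $\mathcal{E}^{[0,1]}_{\lozenge_n}$.
   Context: A semiring is a set with a commutative associative addition and an associative multiplication satisfying both distributive laws (no zero or identity is required); a subsemiring is a nonempty subset closed under both operations. For $n\ge 4$, $\lozenge_n$ is the lattice with $n$ elements $0,1,a_1,\dots,a_{n-2}$, where $0$ is the least element, $1$ is the greatest element and $a_1,\dots,a_{n-2}$ are pairwise incomparable (so $a_i\vee a_j=1$ for $i\ne j$). $\mathcal{E}_{\lozenge_n}$ is the semiring of all maps $\alpha:\lozenge_n\to\lozenge_n$ with $\alpha(x\vee y)=\alpha(x)\vee\alpha(y)$ and $\alpha(0)=0$, with operations $(\alpha+\beta)(x)=\alpha(x)\vee\beta(x)$ and $(\alpha\cdot\beta)(x)=\beta(\alpha(x))$. $\mathcal{E}_{\lozenge_n}(a_i)=\{\alpha\in\mathcal{E}_{\lozenge_n}:\operatorname{Im}(\alpha)\subseteq\{0,a_i,1\}\}$, a subsemiring of $\mathcal{E}_{\lozenge_n}$. Its subsets are: $\mathcal{E}^{[0,i]}_{\lozenge_n}$, the set of $\alpha\in\mathcal{E}_{\lozenge_n}(a_i)$ with $\alpha(1)\neq 1$; $\mathcal{E}^{[i,1]}_{\lozenge_n}$, the set of $\alpha\in\mathcal{E}_{\lozenge_n}(a_i)$ with $\alpha(x)\ne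 0$ for all $x\neq 0$; and $\mathcal{E}^{[0,1]}_{\lozenge_n}$, the set of $\alpha\in\mathcal{E}_{\lozenge_n}$ with $\operatorname{Im}(\alpha)\subseteq\{0,1\}$. *)

theory Defs
  imports Main "HOL-Library.FuncSet"
begin

section \<open>The lattices \<open>\<lozenge>\<^sub>n\<close>\<close>

text \<open>All \<open>\<lozenge>\<^sub>n\<close> are realised inside one lattice with a least element, a greatest element and
  countably many pairwise incomparable elements \<open>Atom k\<close>, where \<open>Atom k\<close> plays the role of
  \<open>a\<^sub>k\<close>. The finite lattice \<open>\<lozenge>\<^sub>n\<close> is the sublattice \<open>lozenge n\<close> below; the index \<open>0\<close> is never used.\<close>

datatype loz = Bot | Top | Atom nat

instantiation loz :: bounded_lattice
begin

definition bot_loz :: loz where "bot_loz = Bot"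
definition top_loz :: loz where "top_loz = Top"

definition less_eq_loz :: "loz \<Rightarrow> loz \<Rightarrow> bool" where
  "less_eq_loz x y \<longleftrightarrow> x = Bot \<or> y = Top \<or> x = y"

definition less_loz :: "loz \<Rightarrow> loz \<Rightarrow> bool" where
  "less_loz x y \<longleftrightarrow> x \<le> y \<and> x \<noteq> (y :: loz)"

definition sup_loz :: "loz \<Rightarrow> loz \<Rightarrow> loz" where
  "sup_loz x y = (if x \<le> y then y else if y \<le> x then x else Top)"

definition inf_loz :: "loz \<Rightarrow> loz \<Rightarrow> loz" where
  "inf_loz x y = (if x \<le> y then x else if y \<le> x then y else Bot)"

instance
  by standard
    (auto simp: bot_loz_def top_loz_def less_eq_loz_def less_loz_def sup_loz_def inf_loz_def)

end

definition lozenge :: "nat \<Rightarrow> loz set" where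
  "lozenge n = {bot, top} \<union> Atom ` {1..n - 2}"

lemma card_lozenge: "n \<ge> 2 \<Longrightarrow> card (lozenge n) = n"
proof -
  assume n: "n \<ge> 2"
  have "card (Atom ` {1..n - 2}) = n - 2"
    by (simp add: card_image inj_on_def)
  moreover have "(bot :: loz) \<noteq> top" "bot \<notin> Atom ` {1..n - 2}" "top \<notin> Atom ` {1..n - 2}"
    by (auto simp: bot_loz_def top_loz_def)
  ultimately show ?thesis
    using n by (simp add: lozenge_def)
qed

lemma sup_in_lozenge: "x \<in> lozenge n \<Longrightarrow> y \<in> lozenge n \<Longrightarrow> sup x y \<in> lozenge n"
  and inf_in_lozenge: "x \<in> lozenge n \<Longrightarrow> y \<in> lozenge n \<Longrightarrow> inf x y \<in> lozenge n"
  by (auto simp: lozenge_def sup_loz_def inf_loz_def bot_loz_def top_loz_def)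

lemma sup_Atom_Atom: "i \<noteq> j \<Longrightarrow> sup (Atom i) (Atom j) = top"
  by (simp add: sup_loz_def less_eq_loz_def top_loz_def)


section \<open>Semirings without zero and identity\<close>

text \<open>\<open>HOL-Algebra.Ring.semiring\<close> requires a zero and an identity, and the type class
  \<open>semiring\<close> has no carrier set.\<close>

definition semiring_on :: "'a set \<Rightarrow> ('a \<Rightarrow> 'a \<Rightarrow> 'a) \<Rightarrow> ('a \<Rightarrow> 'a \<Rightarrow> 'a) \<Rightarrow> bool" where
  "semiring_on S add mul \<longleftrightarrow>
     (\<forall>x\<in>S. \<forall>y\<in>S. add x y \<in> S) \<and>
     (\<forall>x\<in>S. \<forall>y\<in>S. mul x y \<in> S) \<and>
     (\<forall>x\<in>S. \<forall>y\<in>S. add x y = add y x) \<and>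
     (\<forall>x\<in>S. \<forall>y\<in>S. \<forall>z\<in>S. add (add x y) z = add x (add y z)) \<and>
     (\<forall>x\<in>S. \<forall>y\<in>S. \<forall>z\<in>S. mul (mul x y) z = mul x (mul y z)) \<and>
     (\<forall>x\<in>S. \<forall>y\<in>S. \<forall>z\<in>S. mul x (add y z) = add (mul x y) (mul x z)) \<and>
     (\<forall>x\<in>S. \<forall>y\<in>S. \<forall>z\<in>S. mul (add x y) z = add (mul x z) (mul y z))"

definition subsemiring ::
  "'a set \<Rightarrow> 'a set \<Rightarrow> ('a \<Rightarrow> 'a \<Rightarrow> 'a) \<Rightarrow> ('a \<Rightarrow> 'a \<Rightarrow> 'a) \<Rightarrow> bool" where
  "subsemiring T S add mul \<longleftrightarrow>
     T \<subseteq> S \<and> T \<noteq> {} \<and>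
     (\<forall>x\<in>T. \<forall>y\<in>T. add x y \<in> T) \<and>
     (\<forall>x\<in>T. \<forall>y\<in>T. mul x y \<in> T)"


section \<open>The endomorphism semiring of \<open>\<lozenge>\<^sub>n\<close> and its subsets\<close>

text \<open>A map \<open>\<lozenge>\<^sub>n \<rightarrow> \<lozenge>\<^sub>n\<close> is an extensional function, so that equality of functions is equality
  of maps on \<open>lozenge n\<close>.\<close>

definition End_loz :: "nat \<Rightarrow> (loz \<Rightarrow> loz) set" where
  "End_loz n = {\<alpha> \<in> lozenge n \<rightarrow>\<^sub>E lozenge n.
     (\<forall>x\<in>lozenge n. \<forall>y\<in>lozenge n. \<alpha> (sup x y) = sup (\<alpha> x) (\<alpha> y)) \<and> \<alpha> bot = bot}"

definition end_add :: "nat \<Rightarrow> (loz \<Rightarrow> loz) \<Rightarrow> (loz \<Rightarrow> loz) \<Rightarrow> (loz \<Rightarrow> loz)" where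
  "end_add n \<alpha> \<beta> = (\<lambda>x\<in>lozenge n. sup (\<alpha> x) (\<beta> x))"

text \<open>The product applies the left factor first.\<close>

definition end_mul :: "nat \<Rightarrow> (loz \<Rightarrow> loz) \<Rightarrow> (loz \<Rightarrow> loz) \<Rightarrow> (loz \<Rightarrow> loz)" where
  "end_mul n \<alpha> \<beta> = (\<lambda>x\<in>lozenge n. \<beta> (\<alpha> x))"

definition End_at :: "nat \<Rightarrow> nat \<Rightarrow> (loz \<Rightarrow> loz) set" where
  "End_at n i = {\<alpha> \<in> End_loz n. \<alpha> ` lozenge n \<subseteq> {bot, Atom i, top}}"

definition End_0i :: "nat \<Rightarrow> nat \<Rightarrow> (loz \<Rightarrow> loz) set" where
  "End_0i n i = {\<alpha> \<in> End_at n i. \<alpha> top \<noteq> top}"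

definition End_i1 :: "nat \<Rightarrow> nat \<Rightarrow> (loz \<Rightarrow> loz) set" where
  "End_i1 n i = {\<alpha> \<in> End_at n i. \<forall>x\<in>lozenge n. x \<noteq> bot \<longrightarrow> \<alpha> x \<noteq> bot}"

definition End_01 :: "nat \<Rightarrow> (loz \<Rightarrow> loz) set" where
  "End_01 n = {\<alpha> \<in> End_loz n. \<alpha> ` lozenge n \<subseteq> {bot, top}}"

end

(* Only the covering needs an idea: if alpha fixes 1 and kills some nonzero x, then x is an
   atom, and for every other atom y we get 1 = alpha(x v y) = alpha(y). So alpha takes no
   values besides 0 and 1. *)

theory Submission
  imports Defs
begin

lemma bot_in_lozenge [simp]: "bot \<in> lozenge n"
  and top_in_lozenge [simp]: "top \<in> lozenge n"
  by (auto simp: lozenge_def)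

lemma bot_neq_top_loz [simp]: "(bot :: loz) \<noteq> top" "(top :: loz) \<noteq> bot"
  by (simp_all add: bot_loz_def top_loz_def)

lemma Atom_neq_bot_top [simp]:
  "Atom k \<noteq> bot" "bot \<noteq> Atom k" "Atom k \<noteq> top" "top \<noteq> Atom k"
  by (simp_all add: bot_loz_def top_loz_def)

text \<open>Among nonzero elements distinct ones are either two atoms, which join to
  \<open>top\<close>, or include \<open>top\<close> itself. This is the lattice fact behind the
  covering.\<close>

lemma sup_loz_eq_top:
  fixes x y :: loz
  assumes "x \<noteq> y" and "x \<noteq> bot" and "y \<noteq> bot"
  shows "sup x y = top"
  using assms by (auto simp: sup_loz_def less_eq_loz_def bot_loz_def top_loz_def)

text \<open>Each such set is a chain, so the join of two members is one of them.\<close>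

lemma sup_loz_in: "x \<in> {bot, a, top :: loz} \<Longrightarrow> y \<in> {bot, a, top} \<Longrightarrow> sup x y \<in> {bot, a, top}"
  by auto

lemma End_loz_in: "\<alpha> \<in> End_loz n \<Longrightarrow> x \<in> lozenge n \<Longrightarrow> \<alpha> x \<in> lozenge n"
  by (auto simp: End_loz_def)

lemma End_loz_bot: "\<alpha> \<in> End_loz n \<Longrightarrow> \<alpha> bot = bot"
  by (simp add: End_loz_def)

lemma End_loz_sup:
  "\<alpha> \<in> End_loz n \<Longrightarrow> x \<in> lozenge n \<Longrightarrow> y \<in> lozenge n \<Longrightarrow> \<alpha> (sup x y) = sup (\<alpha> x) (\<alpha> y)"
  by (simp add: End_loz_def)

text \<open>Join preservation gives monotonicity: apply the map to \<open>sup x top = top\<close>.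
  This later bounds products in \<open>End_0i\<close>.\<close>

lemma End_loz_le_top:
  assumes "\<alpha> \<in> End_loz n" and "x \<in> lozenge n"
  shows "\<alpha> x \<le> \<alpha> top"
  using End_loz_sup[OF assms, of top] by (simp add: le_iff_sup)

text \<open>Join preservation of a pointwise join comes down to regrouping a join of four values,
  hence \<open>ac_simps\<close>.\<close>

lemma end_add_in_End_loz:
  assumes "\<alpha> \<in> End_loz n" and "\<beta> \<in> End_loz n"
  shows "end_add n \<alpha> \<beta> \<in> End_loz n"
  unfolding End_loz_def end_add_def using assms
  by (auto simp: End_loz_in End_loz_bot End_loz_sup sup_in_lozenge ac_simps)

lemma end_mul_in_End_loz:
  assumes "\<alpha> \<in> End_loz n" and "\<beta> \<in> End_loz n"
  shows "end_mul n \<alpha> \<beta> \<in> End_loz n"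
  unfolding End_loz_def end_mul_def using assms
  by (auto simp: End_loz_in End_loz_bot End_loz_sup sup_in_lozenge)

lemma semiring_on_End_loz: "semiring_on (End_loz n) (end_add n) (end_mul n)"
  unfolding semiring_on_def
proof (intro conjI ballI)
  fix x y z assume x: "x \<in> End_loz n" and y: "y \<in> End_loz n"
  show "end_add n x y \<in> End_loz n" "end_mul n x y \<in> End_loz n"
    using x y by (simp_all add: end_add_in_End_loz end_mul_in_End_loz)
  show "end_add n x y = end_add n y x"
    by (simp add: end_add_def sup.commute)
  show "end_add n (end_add n x y) z = end_add n x (end_add n y z)"
    unfolding end_add_def by (rule restrict_ext) (simp add: sup.assoc)
  \<comment> \<open>The inner product is a restricted function, so evaluating it at a value of
    \<open>x\<close> requires that value to lie in \<open>lozenge n\<close>.\<close>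
  show "end_mul n (end_mul n x y) z = end_mul n x (end_mul n y z)"
    unfolding end_mul_def by (rule restrict_ext) (simp add: End_loz_in[OF x])
  show "end_mul n x (end_add n y z) = end_add n (end_mul n x y) (end_mul n x z)"
    unfolding end_mul_def end_add_def by (rule restrict_ext) (simp add: End_loz_in[OF x])
  \<comment> \<open>In this distributive law \<open>z\<close> is applied to a join of values, so its
    join preservation enters; the other one is pointwise.\<close>
  assume z: "z \<in> End_loz n"
  show "end_mul n (end_add n x y) z = end_add n (end_mul n x z) (end_mul n y z)"
    unfolding end_mul_def end_add_def
    by (rule restrict_ext) (simp add: End_loz_in x y End_loz_sup[OF z])
qed

text \<open>The laws are universally quantified equations and pass to subsets, which leaves only
  closure to check.\<close>

lemma semiring_on_subset:
  assumes "semiring_on S add mul" and "T \<subseteq> S"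
    and "\<And>x y. x \<in> T \<Longrightarrow> y \<in> T \<Longrightarrow> add x y \<in> T"
    and "\<And>x y. x \<in> T \<Longrightarrow> y \<in> T \<Longrightarrow> mul x y \<in> T"
  shows "semiring_on T add mul"
proof -
  have sub: "\<And>x. x \<in> T \<Longrightarrow> x \<in> S"
    using assms(2) by blast
  show ?thesis
    unfolding semiring_on_def
    by (intro conjI ballI assms(3,4); (assumption | use assms(1)[unfolded semiring_on_def] in \<open>metis sub\<close>))
qed

lemma End_at_D:
  assumes "\<alpha> \<in> End_at n i"
  shows "\<alpha> \<in> End_loz n" and "\<And>x. x \<in> lozenge n \<Longrightarrow> \<alpha> x \<in> {bot, Atom i, top}"
  using assms by (auto simp: End_at_def)

lemma end_add_in_End_at:
  assumes "\<alpha> \<in> End_at n i" and "\<beta> \<in> End_at n i"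
  shows "end_add n \<alpha> \<beta> \<in> End_at n i"
proof -
  have "sup (\<alpha> x) (\<beta> x) \<in> {bot, Atom i, top}" if "x \<in> lozenge n" for x
    using that assms[THEN End_at_D(2)] by (intro sup_loz_in)
  then show ?thesis
    using end_add_in_End_loz[OF assms[THEN End_at_D(1)]]
    by (simp add: End_at_def end_add_def image_subset_iff)
qed

text \<open>The right factor is applied last, so the values of the product are values of
  \<open>\<beta>\<close>. Thus \<open>End_at n i\<close> absorbs arbitrary endomorphisms on the
  left.\<close>

lemma end_mul_in_End_at:
  assumes "\<alpha> \<in> End_loz n" and "\<beta> \<in> End_at n i"
  shows "end_mul n \<alpha> \<beta> \<in> End_at n i"
proof -
  have "\<beta> (\<alpha> x) \<in> {bot, Atom i, top}" if "x \<in> lozenge n" for x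
    by (rule End_at_D(2)[OF assms(2) End_loz_in[OF assms(1) that]])
  then show ?thesis
    using end_mul_in_End_loz[OF assms(1) End_at_D(1)[OF assms(2)]]
    by (simp add: End_at_def end_mul_def image_subset_iff)
qed

lemma semiring_on_End_at: "semiring_on (End_at n i) (end_add n) (end_mul n)"
  by (rule semiring_on_subset[OF semiring_on_End_loz])
     (auto intro: end_add_in_End_at end_mul_in_End_at End_at_D(1))

text \<open>The zero map witnesses nonemptiness of \<open>End_01\<close> and also of
  \<open>End_0i\<close>, since it sends \<open>top\<close> to \<open>bot\<close>.\<close>

lemma zero_map_in_End_01: "(\<lambda>x\<in>lozenge n. bot) \<in> End_01 n"
  by (auto simp: End_01_def End_loz_def sup_in_lozenge)

lemma End_01_subset_End_at: "End_01 n \<subseteq> End_at n i"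
  by (auto simp: End_01_def End_at_def)

lemma subsemiring_End_0i: "subsemiring (End_0i n i) (End_at n i) (end_add n) (end_mul n)"
  unfolding subsemiring_def
proof (intro conjI ballI)
  show "End_0i n i \<subseteq> End_at n i"
    by (auto simp: End_0i_def)
  have "(\<lambda>x\<in>lozenge n. bot) \<in> End_0i n i"
    using zero_map_in_End_01 End_01_subset_End_at by (auto simp: End_0i_def)
  then show "End_0i n i \<noteq> {}" by blast
next
  fix \<alpha> \<beta> assume \<alpha>: "\<alpha> \<in> End_0i n i" and \<beta>: "\<beta> \<in> End_0i n i"
  then have at: "\<alpha> \<in> End_at n i" "\<beta> \<in> End_at n i"
    and neq: "\<alpha> top \<noteq> top" "\<beta> top \<noteq> top"
    by (auto simp: End_0i_def)
  have "\<alpha> top \<in> {bot, Atom i}" "\<beta> top \<in> {bot, Atom i}"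
    using at[THEN End_at_D(2), of top] neq by auto
  \<comment> \<open>Both values lie in the chain below \<open>Atom i\<close>, so their join cannot
    reach \<open>top\<close>.\<close>
  then have "sup (\<alpha> top) (\<beta> top) \<noteq> top" by auto
  then show "end_add n \<alpha> \<beta> \<in> End_0i n i"
    using end_add_in_End_at[OF at] by (simp add: End_0i_def end_add_def)
  \<comment> \<open>Monotonicity of \<open>\<beta>\<close> keeps the product at \<open>top\<close>
    below \<open>\<beta> top\<close>, which differs from \<open>top\<close>.\<close>
  have "\<beta> (\<alpha> top) \<le> \<beta> top"
    using End_loz_le_top[OF End_at_D(1)[OF at(2)]] End_loz_in[OF End_at_D(1)[OF at(1)]] by simp
  then have "\<beta> (\<alpha> top) \<noteq> top"
    using neq(2) by (auto simp: top_unique)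
  then show "end_mul n \<alpha> \<beta> \<in> End_0i n i"
    using end_mul_in_End_at[OF End_at_D(1)[OF at(1)] at(2)] by (simp add: End_0i_def end_mul_def)
qed

lemma subsemiring_End_i1: "subsemiring (End_i1 n i) (End_at n i) (end_add n) (end_mul n)"
  unfolding subsemiring_def
proof (intro conjI ballI)
  show "End_i1 n i \<subseteq> End_at n i"
    by (auto simp: End_i1_def)
  \<comment> \<open>This witness preserves joins because a join is \<open>bot\<close> only when both
    arguments are.\<close>
  have "(\<lambda>x\<in>lozenge n. if x = bot then bot else top) \<in> End_i1 n i"
    by (auto simp: End_i1_def End_at_def End_loz_def sup_in_lozenge)
  then show "End_i1 n i \<noteq> {}" by blast
next
  fix \<alpha> \<beta> assume \<alpha>: "\<alpha> \<in> End_i1 n i" and \<beta>: "\<beta> \<in> End_i1 n i"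
  then have at: "\<alpha> \<in> End_at n i" "\<beta> \<in> End_at n i"
    by (auto simp: End_i1_def)
  show "end_add n \<alpha> \<beta> \<in> End_i1 n i"
    using end_add_in_End_at[OF at] \<alpha> by (auto simp: End_i1_def end_add_def)
  show "end_mul n \<alpha> \<beta> \<in> End_i1 n i"
    using end_mul_in_End_at[OF End_at_D(1)[OF at(1)] at(2)] End_loz_in[OF End_at_D(1)[OF at(1)]] \<alpha> \<beta>
    by (auto simp: End_i1_def end_mul_def)
qed

lemma subsemiring_End_01: "subsemiring (End_01 n) (End_at n i) (end_add n) (end_mul n)"
  unfolding subsemiring_def
proof (intro conjI ballI)
  show "End_01 n \<subseteq> End_at n i" by (rule End_01_subset_End_at)
  show "End_01 n \<noteq> {}" using zero_map_in_End_01 by blast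
next
  fix \<alpha> \<beta> assume "\<alpha> \<in> End_01 n" and "\<beta> \<in> End_01 n"
  then have loz: "\<alpha> \<in> End_loz n" "\<beta> \<in> End_loz n"
    and vals: "\<And>x. x \<in> lozenge n \<Longrightarrow> \<alpha> x = bot \<or> \<alpha> x = top"
      "\<And>x. x \<in> lozenge n \<Longrightarrow> \<beta> x = bot \<or> \<beta> x = top"
    by (auto simp: End_01_def)
  have "sup (\<alpha> x) (\<beta> x) \<in> {bot, top}" if "x \<in> lozenge n" for x
    using vals[OF that] by auto
  then show "end_add n \<alpha> \<beta> \<in> End_01 n"
    using end_add_in_End_loz[OF loz] by (simp add: End_01_def end_add_def image_subset_iff)
  have "\<beta> (\<alpha> x) \<in> {bot, top}" if "x \<in> lozenge n" for x
    using vals(2)[OF End_loz_in[OF loz(1) that]] by auto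
  then show "end_mul n \<alpha> \<beta> \<in> End_01 n"
    using end_mul_in_End_loz[OF loz] by (simp add: End_01_def end_mul_def image_subset_iff)
qed

lemma End_loz_kill_imp_End_01:
  assumes \<alpha>: "\<alpha> \<in> End_loz n" and top: "\<alpha> top = top"
    and x: "x \<in> lozenge n" "x \<noteq> bot" "\<alpha> x = bot"
  shows "\<alpha> \<in> End_01 n"
proof -
  have "\<alpha> y \<in> {bot, top}" if y: "y \<in> lozenge n" for y
  \<comment> \<open>The two exceptional elements are sent to \<open>bot\<close>. Every other
    \<open>y\<close>, including \<open>top\<close>, joins with \<open>x\<close> to
    \<open>top\<close>, and \<open>\<alpha> x = bot\<close> contributes nothing to the join of the
    images.\<close>
  proof (cases "y = bot \<or> y = x")
    case True
    then show ?thesis using End_loz_bot[OF \<alpha>] x by auto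
  next
    case False
    then have "sup x y = top"
      using x by (intro sup_loz_eq_top) auto
    then have "top = \<alpha> (sup x y)"
      using top by simp
    also have "\<dots> = \<alpha> y"
      using End_loz_sup[OF \<alpha> x(1) y] x by simp
    finally show ?thesis by simp
  qed
  with \<alpha> show ?thesis by (auto simp: End_01_def)
qed

lemma End_at_eq_Un: "End_at n i = End_0i n i \<union> End_i1 n i \<union> End_01 n"
proof
  show "End_at n i \<subseteq> End_0i n i \<union> End_i1 n i \<union> End_01 n"
    \<comment> \<open>A map outside \<open>End_0i\<close> fixes \<open>top\<close>, and one outside
      \<open>End_i1\<close> kills some nonzero element; a map outside both therefore satisfies the
      hypotheses of \<open>End_loz_kill_imp_End_01\<close>.\<close>
    using End_loz_kill_imp_End_01 End_at_D(1) unfolding End_0i_def End_i1_def by blast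
  show "End_0i n i \<union> End_i1 n i \<union> End_01 n \<subseteq> End_at n i"
    using End_01_subset_End_at by (auto simp: End_0i_def End_i1_def)
qed

theorem corollary5p5:
  fixes n i :: nat
  assumes "n \<ge> 4" and "i \<in> {1..n - 2}"
  shows "semiring_on (End_at n i) (end_add n) (end_mul n) \<and>
    subsemiring (End_0i n i) (End_at n i) (end_add n) (end_mul n) \<and>
    subsemiring (End_i1 n i) (End_at n i) (end_add n) (end_mul n) \<and>
    subsemiring (End_01 n) (End_at n i) (end_add n) (end_mul n) \<and>
    End_at n i = End_0i n i \<union> End_i1 n i \<union> End_01 n"
  by (intro conjI semiring_on_End_at subsemiring_End_0i subsemiring_End_i1 subsemiring_End_01
      End_at_eq_Un)

end
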